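(* The minimal perimeter of a triangle inscribed in a given acute-angled triangle cannot exceed twice the length of the smallest side of the given triangle. That is, if $\triangle AMN$ is an acute-angled triangle and $p$ is the minimal perimeter among all triangles inscribed in $\triangle AMN$, then $p \le 2\min\{|AM|,|MN|,|AN|\}$.
   Context: All objects lie in the Euclidean plane, and $|AB|$ denotes the length of the segment $AB$. A triangle $XYZ$ is inscribed in $\triangle AMN$ if it has one vertex on each side: $X$ on $AM$, $Y$ on $AN$, $Z$ on $MN$. Its perimeter is $|XY|+|YZ|+|XZ|$. By the classical Fagnano theorem, the minimal perimeter among triangles inscribed in an acute-angled triangle is attained by the orthic triangle, whose vertices are the feet of the perpendiculars from the vertices of the given triangle to the opposite sides. *)

theory Defs
  imports "HOL-Analysis.Analysis"
begin

definition angle :: "real^2 \<Rightarrow> real^2 \<Rightarrow> real^2 \<Rightarrow> real" where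
  \<comment> \<open>The unoriented angle at the middle point \<open>B\<close>; only meaningful for \<open>A \<noteq> B\<close> and \<open>C \<noteq> B\<close>.\<close>
  "angle A B C = arccos (((A - B) \<bullet> (C - B)) / (norm (A - B) * norm (C - B)))"

definition is_triangle :: "real^2 \<Rightarrow> real^2 \<Rightarrow> real^2 \<Rightarrow> bool" where
  "is_triangle A B C \<longleftrightarrow> \<not> collinear {A, B, C}"

definition acute_triangle :: "real^2 \<Rightarrow> real^2 \<Rightarrow> real^2 \<Rightarrow> bool" where
  "acute_triangle A B C \<longleftrightarrow> is_triangle A B C \<and>
     angle B A C < pi / 2 \<and> angle A B C < pi / 2 \<and> angle A C B < pi / 2"

text \<open>
  Sides are closed segments, so a vertex of the inscribed triangle may be a vertex of the given
  one. An inscribed triangle has to be a genuine, nondegenerate triangle.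
\<close>

definition inscribed ::
  "real^2 \<Rightarrow> real^2 \<Rightarrow> real^2 \<Rightarrow> real^2 \<Rightarrow> real^2 \<Rightarrow> real^2 \<Rightarrow> bool" where
  "inscribed A M N X Y Z \<longleftrightarrow> is_triangle X Y Z \<and>
     X \<in> closed_segment A M \<and> Y \<in> closed_segment A N \<and> Z \<in> closed_segment M N"

definition perimeter :: "real^2 \<Rightarrow> real^2 \<Rightarrow> real^2 \<Rightarrow> real" where
  "perimeter X Y Z = dist X Y + dist Y Z + dist X Z"

text \<open>The minimum is meant as an attained one, not merely as an infimum.\<close>

definition is_minimal_inscribed_perimeter ::
  "real^2 \<Rightarrow> real^2 \<Rightarrow> real^2 \<Rightarrow> real \<Rightarrow> bool" where
  "is_minimal_inscribed_perimeter A M N p \<longleftrightarrow>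
     (\<exists>X Y Z. inscribed A M N X Y Z \<and> perimeter X Y Z = p) \<and>
     (\<forall>X Y Z. inscribed A M N X Y Z \<longrightarrow> p \<le> perimeter X Y Z)"

end

theory Submission
  imports Defs
begin

text \<open>
  A side \<open>PQ\<close> of the given triangle, traversed back and forth, is a degenerate closed path that
  touches all three sides and has length \<open>2 * dist P Q\<close>. This length is the limit of the
  perimeters of the nondegenerate inscribed triangles \<open>P Y Q\<close>, as \<open>Y\<close> tends to \<open>P\<close>
  along the side \<open>PR\<close> from \<open>P\<close> to the remaining vertex.
  By the triangle inequality the perimeter of \<open>P Y Q\<close> exceeds \<open>2 * dist P Q\<close> by at most
  \<open>2 * dist P Y\<close>, so every lower bound for the perimeters of inscribed triangles is at most
  \<open>2 * dist P Q\<close>.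
\<close>

lemma not_collinear_move_along_side:
  fixes P Q R Y :: "'a::euclidean_space"
  assumes "\<not> collinear {P, Q, R}" "Y \<in> closed_segment P R" "Y \<noteq> P"
  shows "\<not> collinear {P, Y, Q}"
proof
  assume "collinear {P, Y, Q}"
  moreover have "collinear {P, Y, R}"
    using assms(2) by (metis between_imp_collinear between_mem_segment insert_commute)
  ultimately have "collinear {P, Q, R}"
    using assms(3) collinear_3_trans[of Q P Y R] by (simp add: insert_commute)
  with assms(1) show False ..
qed

text \<open>
  The perimeter of a nondegenerate triangle with side \<open>PQ\<close> is always strictly greater than
  \<open>2 * dist P Q\<close>, so no single choice of the third vertex gives the bound; it appears only
  in the limit \<open>Y \<rightarrow> P\<close>.
\<close>

lemma le_twice_side_if_le_thin_perimeters:
  fixes P Q R :: "'a::euclidean_space"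
  assumes "P \<noteq> R"
    and bound: "\<And>Y. Y \<in> closed_segment P R \<Longrightarrow> Y \<noteq> P \<Longrightarrow> p \<le> dist P Y + dist Y Q + dist P Q"
  shows "p \<le> 2 * dist P Q"
proof (rule field_le_epsilon)
  fix e :: real
  assume "0 < e"
  define d where "d = dist P R"
  have "0 < d" using assms(1) by (simp add: d_def)
  define t where "t = min 1 (e / (2 * d))"
  have t: "0 < t" "t \<le> 1" "t * d \<le> e / 2"
    using \<open>0 < d\<close> \<open>0 < e\<close> by (auto simp: t_def min_def field_simps)
  define Y where "Y = P + t *\<^sub>R (R - P)"
  have Y: "Y \<in> closed_segment P R" "Y \<noteq> P"
    using t assms(1) by (auto simp: Y_def in_segment algebra_simps intro!: exI[of _ t])
  have "dist P Y = t * d"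
    using t by (simp add: Y_def d_def dist_norm norm_minus_commute)
  moreover have "dist Y Q \<le> dist P Y + dist P Q"
    by (metis dist_commute dist_triangle)
  ultimately show "p \<le> 2 * dist P Q + e"
    using bound[OF Y] t by linarith
qed

theorem lemma4p2:
  fixes A M N :: "real^2" and p :: real
  assumes "acute_triangle A M N"
    and "is_minimal_inscribed_perimeter A M N p"
  shows "p \<le> 2 * Min {dist A M, dist M N, dist A N}"
proof -
  have nc: "\<not> collinear {A, M, N}"
    using assms(1) by (simp add: acute_triangle_def is_triangle_def)
  then have distinct: "A \<noteq> M" "A \<noteq> N" "N \<noteq> A"
    by (auto simp: insert_commute)
  have minimal: "p \<le> dist X Y + dist Y Z + dist X Z"
    if "\<not> collinear {X, Y, Z}" "X \<in> closed_segment A M" "Y \<in> closed_segment A N"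
      "Z \<in> closed_segment M N" for X Y Z
    using assms(2) that
    unfolding is_minimal_inscribed_perimeter_def inscribed_def is_triangle_def perimeter_def
    by blast
  have "p \<le> 2 * dist A M"
  proof (rule le_twice_side_if_le_thin_perimeters[OF distinct(2)])
    fix Y assume Y: "Y \<in> closed_segment A N" "Y \<noteq> A"
    show "p \<le> dist A Y + dist Y M + dist A M"
      using minimal[of A Y M] not_collinear_move_along_side[OF nc Y] Y by simp
  qed
  moreover have "p \<le> 2 * dist A N"
  proof (rule le_twice_side_if_le_thin_perimeters[OF distinct(1)])
    fix X assume X: "X \<in> closed_segment A M" "X \<noteq> A"
    have "\<not> collinear {A, X, N}"
      using not_collinear_move_along_side[of A N M X] X nc by (simp add: insert_commute)
    then show "p \<le> dist A X + dist X N + dist A N"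
      using minimal[of X A N] X by (simp add: insert_commute dist_commute)
  qed
  moreover have "p \<le> 2 * dist N M"
  proof (rule le_twice_side_if_le_thin_perimeters[OF distinct(3)])
    fix Y assume Y: "Y \<in> closed_segment N A" "Y \<noteq> N"
    have "\<not> collinear {N, Y, M}"
      using not_collinear_move_along_side[of N M A Y] Y nc by (simp add: insert_commute)
    then show "p \<le> dist N Y + dist Y M + dist N M"
      using minimal[of M Y N] Y by (simp add: insert_commute dist_commute closed_segment_commute)
  qed
  ultimately show ?thesis
    by (simp add: dist_commute min_def)
qed

end
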